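(* Let $\chi$ be a primitive nonprincipal odd Dirichlet character with conductor $q$. Let $\Phi_q=\{j\mid 1\le j\le \frac{q-1}{2},\ \gcd(j,q)=1\}=\{j_1,\ldots,j_\ell\}$, where $\ell=|\Phi_q|=\frac12\varphi(q)$. Then for all integers $n\ge1$, $$L_n(\chi)=\frac{i^{\,n-\ell}}{\epsilon(q)\,n!}\left(\frac{\pi}{q}\right)^n\sum_{\delta}P(\delta)\,e^{i\pi j(\delta)/q}\left(\delta_1\chi(j_1)+\dots+\delta_\ell\chi(j_\ell)\right)^n,$$ where the sum is over all $2^\ell$ vectors $\delta=(\delta_1,\ldots,\delta_\ell)$ with each $\delta_\lambda=\pm1$, $P(\delta):=\delta_1\cdots\delta_\ell$, and $j(\delta):=\delta_1j_1+\dots+\delta_\ell j_\ell$.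
   Context: $L_n(\chi):=\sum_{1\le k_1<\dots<k_n}\frac{\chi(k_1)}{k_1}\cdots\frac{\chi(k_n)}{k_n}$, understood as the limit as $N\to\infty$ of the sums over $1\le k_1<\dots<k_n\le N$. $\varphi$ is Euler's totient function. $\epsilon(q)=\sqrt p$ if $q$ is a power of a prime $p$, and $\epsilon(q)=1$ otherwise. Odd means $\chi(-1)=-1$. *)

theory Defs
  imports Complex_Main "HOL-Library.FuncSet" "HOL-Number_Theory.Number_Theory"
begin

text \<open>
  Characters are functions on all integers, vanishing exactly off the residues coprime to the
  modulus; the value at 1 is then forced to be 1.
\<close>

definition dirichlet_character :: "nat \<Rightarrow> (int \<Rightarrow> complex) \<Rightarrow> bool" where
  "dirichlet_character q \<chi> \<longleftrightarrow>
     q > 0 \<and>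
     (\<forall>a b. \<chi> (a * b) = \<chi> a * \<chi> b) \<and>
     (\<forall>a. \<chi> (a + int q) = \<chi> a) \<and>
     (\<forall>a. \<chi> a \<noteq> 0 \<longleftrightarrow> coprime a (int q))"

definition principal_character :: "nat \<Rightarrow> (int \<Rightarrow> complex) \<Rightarrow> bool" where
  "principal_character q \<chi> \<longleftrightarrow> (\<forall>a. \<chi> a = (if coprime a (int q) then 1 else 0))"

definition odd_character :: "(int \<Rightarrow> complex) \<Rightarrow> bool" where
  "odd_character \<chi> \<longleftrightarrow> \<chi> (-1) = -1"

definition induced_by_modulus :: "nat \<Rightarrow> (int \<Rightarrow> complex) \<Rightarrow> nat \<Rightarrow> bool" where
  "induced_by_modulus q \<chi> d \<longleftrightarrow>
     d dvd q \<and>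
     (\<exists>\<psi>. dirichlet_character d \<psi> \<and> (\<forall>a. coprime a (int q) \<longrightarrow> \<chi> a = \<psi> a))"

definition conductor :: "nat \<Rightarrow> (int \<Rightarrow> complex) \<Rightarrow> nat" where
  "conductor q \<chi> = (LEAST d. induced_by_modulus q \<chi> d)"

definition primitive_character :: "nat \<Rightarrow> (int \<Rightarrow> complex) \<Rightarrow> bool" where
  "primitive_character q \<chi> \<longleftrightarrow> dirichlet_character q \<chi> \<and> conductor q \<chi> = q"

text \<open>A tuple \<open>1 \<le> k\<^sub>1 < \<dots> < k\<^sub>n \<le> N\<close> is a strictly increasing list of length \<open>n\<close>.\<close>

definition multiple_L_partial :: "nat \<Rightarrow> (int \<Rightarrow> complex) \<Rightarrow> nat \<Rightarrow> complex" where
  "multiple_L_partial n \<chi> N =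
     (\<Sum>ks | length ks = n \<and> sorted_wrt (<) ks \<and> set ks \<subseteq> {1..N}.
        \<Prod>k\<leftarrow>ks. \<chi> (int k) / of_nat k)"

definition multiple_L :: "nat \<Rightarrow> (int \<Rightarrow> complex) \<Rightarrow> complex" where
  "multiple_L n \<chi> = lim (multiple_L_partial n \<chi>)"

text \<open>For a prime power, \<^const>\<open>aprimedivisor\<close> is its unique prime divisor.\<close>

definition epsilon :: "nat \<Rightarrow> real" where
  "epsilon q = (if primepow q then sqrt (real (aprimedivisor q)) else 1)"

definition Phi_set :: "nat \<Rightarrow> nat set" where
  "Phi_set q = {j. 1 \<le> j \<and> real j \<le> (real q - 1) / 2 \<and> gcd j q = 1}"

end

theory Submission
  imports Defs "HOL-Complex_Analysis.Complex_Analysis"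
begin

text \<open>
  The numbers \<open>L\<^sub>n(\<chi>)\<close> are the Taylor coefficients at \<open>0\<close> of \<open>\<Prod>k\<ge>1. 1 + \<chi>(k) x / k\<close>. Since \<open>\<chi>\<close>
  is odd, the factors with \<open>k \<equiv> j\<close> and \<open>k \<equiv> -j\<close> modulo \<open>q\<close> combine, by the product formula for
  the sine, to \<open>sin (\<pi> (j + \<chi>(j) x) / q) / sin (\<pi> j / q)\<close>. The product of the \<open>2 sin (\<pi> j / q)\<close> over
  \<open>j \<in> \<Phi>\<^sub>q\<close> is \<open>\<epsilon>(q)\<close>, because its square is the value at \<open>1\<close> of the \<open>q\<close>-th cyclotomic polynomial.
  Writing each sine as a difference of two exponentials and expanding the product gives the
  sum over the sign vectors \<open>\<delta>\<close>.
\<close>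

(* HOL-Analysis uses the letter chi as a binder. *)
unbundle no vec_syntax

subsection \<open>Products of sines at rational multiples of \<open>\<pi>\<close>\<close>

text \<open>Factor 1 + X + ... + X^(n-1) over the nontrivial n-th roots of unity and evaluate at
  1.\<close>

lemma prod_one_minus_roots_unity:
  assumes n: "n > 0"
  shows "(\<Prod>z\<in>{z::complex. z ^ n = 1} - {1}. 1 - z) = of_nat n"
proof -
  define A where "A = {z::complex. z ^ n = 1} - {1}"
  define Q :: "complex poly" where "Q = (\<Sum>i<n. monom 1 i)"
  have fin: "finite A" using n by (auto simp: A_def intro: finite_roots_unity)
  have card: "card A = n - 1"
    using n card_complex_roots_unity[of n] by (simp add: A_def card_Diff_singleton)
  have deg: "degree (\<Prod>z\<in>A. [:-z, 1:]) = n - 1"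
    by (subst degree_prod_eq_sum_degree) (auto simp: card)
  \<comment> \<open>Both polynomials have degree at most n - 1 and coefficient 1 there, so their
    difference has degree below n - 1 or is 0. It vanishes at the n - 1 points of \<open>A\<close>,
    hence identically.\<close>
  have "(\<Prod>z\<in>A. [:-z, 1:]) = Q"
  proof (rule poly_eqI_degree_lead_coeff[where n = "n - 1" and A = A])
    show "degree Q \<le> n - 1"
      unfolding Q_def by (intro degree_sum_le) (auto intro: order_trans[OF degree_monom_le])
    have "coeff (\<Prod>z\<in>A. [:-z, 1:]) (n - 1) = lead_coeff (\<Prod>z\<in>A. [:-z, 1:])"
      by (simp only: deg)
    also have "\<dots> = 1" by (simp add: lead_coeff_prod)
    also have "\<dots> = coeff Q (n - 1)"
      using n by (simp add: Q_def coeff_sum)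
    finally show "coeff (\<Prod>z\<in>A. [:-z, 1:]) (n - 1) = coeff Q (n - 1)" .
    show "poly (\<Prod>z\<in>A. [:-z, 1:]) z = poly Q z" if "z \<in> A" for z
    proof -
      have "poly Q z = 0"
        using that geometric_sum[of z n] by (simp add: Q_def poly_sum poly_monom A_def)
      thus ?thesis using that fin by (auto simp: poly_prod prod_zero_iff)
    qed
  qed (use deg card in auto)
  hence "poly (\<Prod>z\<in>A. [:-z, 1:]) 1 = poly Q 1" by simp
  thus ?thesis
    by (simp add: poly_prod Q_def poly_sum poly_monom A_def)
qed

text \<open>Take norms in \<open>prod_one_minus_roots_unity\<close>: the chord from 1 to exp(2 pi i
  k / n) has length 2 sin(pi k / n), which is positive for 0 < k < n.\<close>

lemma prod_two_sin_multiples_pi: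
  assumes n: "n > 0"
  shows "(\<Prod>k\<in>{0<..<n}. 2 * sin (pi * real k / real n)) = real n"
proof -
  define f where "f = (\<lambda>k::nat. cis (2 * pi * real k / real n))"
  have "bij_betw f ({..<n} - {0}) ({z. z ^ n = 1} - {f 0})"
    using n Complex.bij_betw_roots_unity[OF n] unfolding f_def
    by (intro bij_betw_DiffI) (auto simp: bij_betw_def)
  moreover have "{..<n} - {0} = {0<..<n}" "f 0 = 1" by (auto simp: f_def)
  ultimately have bij: "bij_betw f {0<..<n} ({z. z ^ n = 1} - {1})" by simp
  have *: "norm (1 - f k) = 2 * sin (pi * real k / real n)" if "k \<in> {0<..<n}" for k
  proof -
    have "norm (1 - f k) = norm (exp (\<i> * of_real (2 * pi * real k / real n)) - 1)"
      by (simp add: f_def cis_conv_exp norm_minus_commute)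
    also have "\<dots> = 2 * \<bar>sin (pi * real k / real n)\<bar>"
      by (subst dist_exp_i_1) simp
    also have "\<dots> = 2 * sin (pi * real k / real n)"
      using that sin_gt_zero[of "pi * real k / real n"] by (auto simp: field_simps)
    finally show ?thesis .
  qed
  have "real n = norm (\<Prod>z\<in>{z::complex. z ^ n = 1} - {1}. 1 - z)"
    by (simp add: prod_one_minus_roots_unity[OF n])
  also have "\<dots> = norm (\<Prod>k\<in>{0<..<n}. 1 - f k)"
    by (simp add: prod.reindex_bij_betw[OF bij])
  also have "\<dots> = (\<Prod>k\<in>{0<..<n}. 2 * sin (pi * real k / real n))"
    unfolding prod_norm[symmetric] by (intro prod.cong * refl)
  finally show ?thesis ..
qed

lemma sin_totative_pos:
  assumes "n > 1" "a \<in> totatives n"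
  shows "sin (pi * real a / real n) > 0"
  using assms totatives_less[of a n]
  by (intro sin_gt_zero) (auto simp: in_totatives_iff field_simps)

text \<open>Every fraction k/n strictly between 0 and 1 has a unique reduced form a/d with d > 1 a
  divisor of n, and \<open>g\<close> sees only the value of the fraction.\<close>

lemma sum_totatives_divisors:
  fixes g :: "real \<Rightarrow> 'a :: comm_monoid_add"
  assumes n: "n > 0"
  shows "(\<Sum>k\<in>{0<..<n}. g (real k / real n)) =
         (\<Sum>d | d dvd n \<and> d > 1. \<Sum>a\<in>totatives d. g (real a / real d))"
proof -
  define h where "h = (\<lambda>k. g (real k / real n))"
  \<comment> \<open>Here \<open>d\<close> is the gcd of k and n. The condition d < n removes exactly
    k = n.\<close>
  have "{0<..<n} = (\<Union>d\<in>{d. d dvd n \<and> d < n}. {k\<in>{0<..n}. gcd k n = d})"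
  proof safe
    fix k assume k: "k \<in> {0<..<n}"
    hence "gcd k n < n"
      by (metis gcd_le1_nat greaterThanLessThan_iff le_less_trans not_gr_zero)
    thus "k \<in> (\<Union>d\<in>{d. d dvd n \<and> d < n}. {k\<in>{0<..n}. gcd k n = d})" using k by auto
  next
    fix k assume "k \<in> {0<..n}" "gcd k n < n"
    thus "k \<in> {0<..<n}" by (cases "k = n") auto
  qed
  hence "sum h {0<..<n} = (\<Sum>d | d dvd n \<and> d < n. \<Sum>k\<in>{k\<in>{0<..n}. gcd k n = d}. h k)"
    using n by (simp only:) (subst sum.UNION_disjoint, auto)
  also have "\<dots> = (\<Sum>d | d dvd n \<and> d < n. \<Sum>a\<in>totatives (n div d). h (a * d))"
    using n by (intro sum.cong refl sum.reindex_bij_betw[symmetric] bij_betw_totatives_gcd_eq) auto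
  also have "\<dots> = (\<Sum>d | d dvd n \<and> d < n. \<Sum>a\<in>totatives (n div d). g (real a / real (n div d)))"
  proof (intro sum.cong refl)
    fix d a assume "d \<in> {d. d dvd n \<and> d < n}"
    thus "h (a * d) = g (real a / real (n div d))"
      using n by (auto simp: h_def elim!: dvdE)
  qed
  \<comment> \<open>Passing to the complementary divisor turns the gcd into the reduced
    denominator.\<close>
  also have "\<dots> = (\<Sum>d | d dvd n \<and> d > 1. \<Sum>a\<in>totatives d. g (real a / real d))"
    (is "(\<Sum>d\<in>_. ?T (n div d)) = sum ?T _")
    using n by (intro sum.reindex_bij_witness[where i = "(div) n" and j = "(div) n"
      and S = "{d. d dvd n \<and> d < n}" and g = "\<lambda>d. ?T (n div d)" and h = ?T]) (auto elim: dvdE)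
  finally show ?thesis by (simp add: h_def)
qed

text \<open>The left side is the logarithm of the n-th cyclotomic polynomial at 1. Summed over the
  divisors d > 1 of n, both sides give ln n, so strong induction cancels all terms but d =
  n.\<close>

lemma sum_ln_sin_totatives:
  assumes "n > 1"
  shows "(\<Sum>a\<in>totatives n. ln (2 * sin (pi * real a / real n))) = mangoldt n"
  using assms
proof (induction n rule: less_induct)
  case (less n)
  define D where "D = {d. d dvd n \<and> d > 1}"
  define S where "S = (\<lambda>d. \<Sum>a\<in>totatives d. ln (2 * sin (pi * (real a / real d))))"
  have fin: "finite D" using less.prems unfolding D_def by simp
  have n: "n \<in> D" using less.prems by (simp add: D_def)
  have IH: "S d = mangoldt d" if "d \<in> D - {n}" for d
  proof -
    have "d < n" "d > 1"
      using that less.prems by (auto simp: D_def dest: dvd_imp_le intro: le_neq_implies_less)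
    thus ?thesis using less.IH[of d] by (simp add: S_def)
  qed
  have "sum S D = (\<Sum>k\<in>{0<..<n}. ln (2 * sin (pi * (real k / real n))))"
    using less.prems sum_totatives_divisors[of n "\<lambda>x. ln (2 * sin (pi * x))"]
    by (simp add: S_def D_def)
  also have "\<dots> = ln (\<Prod>k\<in>{0<..<n}. 2 * sin (pi * real k / real n))"
  proof -
    have "sin (pi * real k / real n) > 0" if "k \<in> {0<..<n}" for k
      using that by (intro sin_gt_zero) (auto simp: field_simps)
    hence "2 * sin (pi * real k / real n) \<noteq> 0" if "k \<in> {0<..<n}" for k
      using that by (metis less_irrefl mult_eq_0_iff zero_neq_numeral)
    thus ?thesis by (subst ln_prod) auto
  qed
  also have "\<dots> = ln (real n)"
    using less.prems by (subst prod_two_sin_multiples_pi) auto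
  also have "\<dots> = (\<Sum>d | d dvd n. mangoldt d)"
    using mangoldt_sum[of n, where ?'a = real] less.prems by simp
  \<comment> \<open>The divisor 1 may be dropped because the von Mangoldt function vanishes
    there.\<close>
  also have "\<dots> = sum mangoldt D"
  proof (rule sum.mono_neutral_right)
    show "\<forall>i\<in>{d. d dvd n} - D. mangoldt i = (0::real)"
    proof
      fix i assume "i \<in> {d. d dvd n} - D"
      hence "i = 0 \<or> i = Suc 0" unfolding D_def by (auto simp: not_less)
      thus "mangoldt i = (0::real)" by auto
    qed
  qed (use less.prems in \<open>auto simp: D_def\<close>)
  finally have "S n + sum S (D - {n}) = mangoldt n + sum mangoldt (D - {n})"
    using fin n by (simp add: sum.remove)
  moreover have "sum S (D - {n}) = sum mangoldt (D - {n})" using IH by (intro sum.cong) auto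
  ultimately show ?case by (simp add: S_def)
qed

section \<open>Reduced residues in the lower half and the constant \<open>epsilon q\<close>\<close>

lemma Phi_set_eq: "Phi_set q = {j \<in> totatives q. 2 * j < q}"
proof -
  have "real j \<le> (real q - 1) / 2 \<longleftrightarrow> 2 * j < q" for j
  proof -
    have "2 * j < q \<longleftrightarrow> real (2 * j + 1) \<le> real q" unfolding of_nat_le_iff by linarith
    thus ?thesis by (auto simp: field_simps)
  qed
  thus ?thesis
    by (auto simp: Phi_set_def in_totatives_iff intro: gcd_eq_1_imp_coprime)
qed

text \<open>The reflection j -> q - j preserves coprimality to q and exchanges the two halves. Its
  fixed point q/2 divides q, so it could be coprime to q only for q = 2.\<close>

lemma totatives_halves:
  assumes q: "q > 2"
  shows "totatives q = Phi_set q \<union> (\<lambda>j. q - j) ` Phi_set q"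
    and "Phi_set q \<inter> (\<lambda>j. q - j) ` Phi_set q = {}"
    and "inj_on (\<lambda>j. q - j) (Phi_set q)"
proof -
  have refl: "q - j \<in> totatives q" if "j \<in> totatives q" for j
  proof -
    have j: "j < q" "coprime j q" "j > 0"
      using that totatives_less[of j q] q by (auto simp: in_totatives_iff)
    have "coprime (q - j) q"
    proof (rule coprimeI)
      fix d assume d: "d dvd q - j" "d dvd q"
      hence "d dvd j" using j(1) dvd_diffD1[of d q j] by simp
      thus "is_unit d" using j(2) d(2) coprime_common_divisor by blast
    qed
    thus ?thesis using j by (simp add: in_totatives_iff)
  qed
  show "totatives q = Phi_set q \<union> (\<lambda>j. q - j) ` Phi_set q"
  proof (intro equalityI subsetI)
    fix a assume a: "a \<in> totatives q"
    have "2 * a \<noteq> q"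
    proof
      assume eq: "2 * a = q"
      hence "a dvd q" by auto
      hence "a = 1" using a by (simp add: in_totatives_iff coprime_absorb_left)
      thus False using eq q by simp
    qed
    then consider "2 * a < q" | "2 * a > q" by linarith
    thus "a \<in> Phi_set q \<union> (\<lambda>j. q - j) ` Phi_set q"
    proof cases
      case 2
      have "a = q - (q - a)" using totatives_le[OF a] by simp
      moreover have "q - a \<in> Phi_set q" using 2 refl[OF a] q by (auto simp: Phi_set_eq)
      ultimately show ?thesis by blast
    qed (use a q in \<open>auto simp: Phi_set_eq\<close>)
  next
    fix a assume "a \<in> Phi_set q \<union> (\<lambda>j. q - j) ` Phi_set q"
    thus "a \<in> totatives q" using refl q by (auto simp: Phi_set_eq)
  qed
  have less: "2 * j < q" if "j \<in> Phi_set q" for j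
    using that q by (simp add: Phi_set_eq)
  show "Phi_set q \<inter> (\<lambda>j. q - j) ` Phi_set q = {}"
  proof safe
    fix j assume "j \<in> Phi_set q" "q - j \<in> Phi_set q"
    from this[THEN less] show "q - j \<in> {}" by linarith
  qed
  show "inj_on (\<lambda>j. q - j) (Phi_set q)"
  proof (rule inj_onI)
    fix j k assume jk: "j \<in> Phi_set q" "k \<in> Phi_set q" and "q - j = q - k"
    with less[OF jk(1)] less[OF jk(2)] show "j = k" by linarith
  qed
qed

lemma prod_totatives_halves:
  fixes f :: "nat \<Rightarrow> 'a :: comm_monoid_mult"
  assumes q: "q > 2"
  shows "prod f (totatives q) = (\<Prod>j\<in>Phi_set q. f j * f (q - j))"
proof -
  have "finite (Phi_set q)" using q by (simp add: Phi_set_eq)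
  thus ?thesis
    using totatives_halves[OF q]
    by (simp add: prod.union_disjoint prod.reindex prod.distrib)
qed

lemma card_Phi_set: "q > 2 \<Longrightarrow> 2 * card (Phi_set q) = totient q"
proof -
  assume q: "q > 2"
  have "finite (Phi_set q)" using q by (simp add: Phi_set_eq)
  thus ?thesis
    using totatives_halves[OF q]
    by (simp add: totient_def card_Un_disjoint card_image)
qed

text \<open>Since sin(pi - t) = sin t, the product over all totatives is the square of the product
  over \<open>Phi_set q\<close>. The full product is exp(Lambda(q)), that is, p for a power of a
  prime p and 1 otherwise; positivity selects the square root.\<close>

lemma prod_two_sin_Phi_set:
  assumes q: "q > 2"
  shows "(\<Prod>j\<in>Phi_set q. 2 * sin (pi * real j / real q)) = epsilon q"
proof -
  define P where "P = (\<Prod>j\<in>Phi_set q. 2 * sin (pi * real j / real q))"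
  have pos: "2 * sin (pi * real j / real q) > 0" if "j \<in> totatives q" for j
    using sin_totative_pos[of q j] q that by auto
  have "P > 0" unfolding P_def using pos q by (intro prod_pos) (auto simp: Phi_set_eq)
  have "exp (mangoldt q) = exp (\<Sum>a\<in>totatives q. ln (2 * sin (pi * real a / real q)))"
    using q by (subst sum_ln_sin_totatives) auto
  also have "\<dots> = (\<Prod>a\<in>totatives q. 2 * sin (pi * real a / real q))"
    using pos by (subst exp_sum) (auto intro!: prod.cong)
  also have "\<dots> = (\<Prod>j\<in>Phi_set q. (2 * sin (pi * real j / real q))\<^sup>2)"
    unfolding prod_totatives_halves[OF q]
  proof (rule prod.cong)
    fix j assume "j \<in> Phi_set q"
    hence "j \<le> q" using q by (auto simp: Phi_set_eq)
    hence "pi * real (q - j) / real q = pi - pi * real j / real q"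
      using q by (simp add: of_nat_diff field_simps)
    thus "2 * sin (pi * real j / real q) * (2 * sin (pi * real (q - j) / real q)) =
          (2 * sin (pi * real j / real q))\<^sup>2"
      by (simp add: power2_eq_square)
  qed auto
  also have "\<dots> = P\<^sup>2" by (simp add: P_def prod_power_distrib)
  finally have "P = sqrt (exp (mangoldt q))" using \<open>P > 0\<close> by simp
  also have "\<dots> = epsilon q"
    using aprimedivisor_pos_nat[of q] q by (auto simp: epsilon_def mangoldt_def)
  finally show ?thesis by (simp add: P_def)
qed

subsection \<open>The generating polynomial of the truncated sums\<close>

lemma multiple_L_partial_0 [simp]: "multiple_L_partial 0 \<chi> N = 1"
proof -
  have "{ks :: nat list. length ks = 0 \<and> sorted_wrt (<) ks \<and> set ks \<subseteq> {1..N}} = {[]}" by auto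
  thus ?thesis by (simp add: multiple_L_partial_def)
qed

lemma multiple_L_partial_Suc_0 [simp]: "multiple_L_partial (Suc n) \<chi> 0 = 0"
proof -
  have "{ks :: nat list. length ks = Suc n \<and> sorted_wrt (<) ks \<and> set ks \<subseteq> {1..0}} = {}" by auto
  thus ?thesis unfolding multiple_L_partial_def by (simp only:) simp
qed

text \<open>Split the increasing lists according to whether their last entry is N + 1. This mirrors
  multiplying the generating polynomial by one more linear factor.\<close>

lemma multiple_L_partial_Suc_Suc:
  "multiple_L_partial (Suc n) \<chi> (Suc N) =
     multiple_L_partial (Suc n) \<chi> N + \<chi> (int (Suc N)) / of_nat (Suc N) * multiple_L_partial n \<chi> N"
proof -
  define T where "T = (\<lambda>n N. {ks :: nat list. length ks = n \<and> sorted_wrt (<) ks \<and> set ks \<subseteq> {1..N}})"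
  define w where "w = (\<lambda>ks. \<Prod>k\<leftarrow>ks. \<chi> (int k) / of_nat k)"
  have fin: "finite (T n N)" for n N
    by (rule finite_subset[OF _ finite_lists_length_eq[of "{1..N}" n]]) (auto simp: T_def)
  have "T (Suc n) (Suc N) = T (Suc n) N \<union> (\<lambda>ks. ks @ [Suc N]) ` T n N"
  proof (intro equalityI subsetI)
    fix ks assume ks: "ks \<in> T (Suc n) (Suc N)"
    then obtain xs x where xs: "ks = xs @ [x]" "length xs = n"
      by (auto simp: T_def length_Suc_conv_rev)
    have less: "\<And>y. y \<in> set xs \<Longrightarrow> y < x" and sorted: "sorted_wrt (<) xs"
      and sub: "set xs \<subseteq> {1..Suc N}" and x: "1 \<le> x" "x \<le> Suc N"
      using ks xs by (auto simp: T_def sorted_wrt_append)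
    have sub': "set xs \<subseteq> {1..N}" using less sub x by fastforce
    show "ks \<in> T (Suc n) N \<union> (\<lambda>ks. ks @ [Suc N]) ` T n N"
    proof (cases "x = Suc N")
      case True
      thus ?thesis using xs sorted sub' by (auto simp: T_def)
    next
      case False
      thus ?thesis using xs ks sub' x by (auto simp: T_def)
    qed
  next
    fix ks assume "ks \<in> T (Suc n) N \<union> (\<lambda>ks. ks @ [Suc N]) ` T n N"
    thus "ks \<in> T (Suc n) (Suc N)"
      by (fastforce simp: T_def sorted_wrt_append)
  qed
  moreover have "T (Suc n) N \<inter> (\<lambda>ks. ks @ [Suc N]) ` T n N = {}" by (auto simp: T_def)
  moreover have "inj_on (\<lambda>ks. ks @ [Suc N]) (T n N)" by (auto simp: inj_on_def)
  ultimately have "sum w (T (Suc n) (Suc N)) = sum w (T (Suc n) N) + (\<Sum>ks\<in>T n N. w (ks @ [Suc N]))"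
    by (simp add: fin sum.union_disjoint sum.reindex)
  thus ?thesis
    by (simp add: multiple_L_partial_def T_def w_def sum_distrib_left mult_ac)
qed

text \<open>The truncated sums are the elementary symmetric functions of the numbers \<chi>(k)/k.
  The index n stays arbitrary in the induction because the new factor brings in the coefficient at n
  - 1.\<close>

lemma coeff_prod_linear_eq_multiple_L_partial:
  "coeff (\<Prod>k=1..N. [:1, \<chi> (int k) / of_nat k:]) n = multiple_L_partial n \<chi> N"
proof (induction N arbitrary: n)
  case 0
  show ?case by (cases n) auto
next
  case (Suc N)
  show ?case
  proof (cases n)
    case 0
    thus ?thesis using Suc.IH[of 0] by (simp add: coeff_mult)
  next
    case (Suc m)
    thus ?thesis
      using Suc.IH[of "Suc m"] Suc.IH[of m]
      by (simp add: multiple_L_partial_Suc_Suc mult.commute[of _ "[:_, _:]"] del: of_nat_Suc)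
  qed
qed

lemma higher_deriv_poly:
  fixes p :: "complex poly"
  shows "(deriv ^^ n) (poly p) = poly ((pderiv ^^ n) p)"
proof (induction n)
  case (Suc n)
  have "deriv (poly r) = poly (pderiv r)" for r :: "complex poly"
    by (rule ext, rule DERIV_imp_deriv, rule poly_DERIV)
  thus ?case using Suc.IH by simp
qed auto

text \<open>Coefficients become derivatives at 0, so limits of coefficients can be obtained from
  complex analysis.\<close>

lemma higher_deriv_poly_0:
  fixes p :: "complex poly"
  shows "(deriv ^^ n) (poly p) 0 = fact n * coeff p n"
  by (simp add: higher_deriv_poly poly_0_coeff_0 coeff_higher_pderiv pochhammer_fact)

lemma higher_deriv_sum_exp:
  fixes c a :: "'a \<Rightarrow> complex"
  shows "(deriv ^^ n) (\<lambda>x. \<Sum>d\<in>D. c d * exp (a d * x)) = (\<lambda>x. \<Sum>d\<in>D. c d * a d ^ n * exp (a d * x))"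
proof (induction n)
  case (Suc n)
  have "deriv (\<lambda>x. \<Sum>d\<in>D. c d * a d ^ n * exp (a d * x)) x =
        (\<Sum>d\<in>D. c d * a d ^ Suc n * exp (a d * x))" for x
    by (rule DERIV_imp_deriv) (auto intro!: derivative_eq_intros sum.cong)
  thus ?case using Suc.IH by auto
qed auto

subsection \<open>Locally uniform convergence to a quotient of sines\<close>

text \<open>Uniform limits multiply when the limit functions are bounded; continuity on a compact
  set supplies the bounds.\<close>

lemma uniform_limit_prod_compact:
  fixes f :: "'i \<Rightarrow> 'n \<Rightarrow> 'a :: topological_space \<Rightarrow> 'b :: {real_normed_field}"
  assumes "finite I" "compact K"
    and "\<And>i. i \<in> I \<Longrightarrow> uniform_limit K (f i) (g i) F"
    and "\<And>i. i \<in> I \<Longrightarrow> continuous_on K (g i)"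
  shows "uniform_limit K (\<lambda>n x. \<Prod>i\<in>I. f i n x) (\<lambda>x. \<Prod>i\<in>I. g i x) F"
  using assms(1,3,4)
proof (induction I rule: finite_induct)
  case (insert i I)
  have "uniform_limit K (\<lambda>n x. f i n x * (\<Prod>i\<in>I. f i n x)) (\<lambda>x. g i x * (\<Prod>i\<in>I. g i x)) F"
    using insert assms(2)
    by (intro uniform_lim_mult insert.IH compact_imp_bounded compact_continuous_image
              continuous_on_prod) auto
  thus ?case using insert.hyps by simp
qed (auto intro: uniform_limit_const)

text \<open>The extra factor M + z completes the product to Euler's truncated product z * (1 -
  z^2/1^2) ... (1 - z^2/M^2). The weight M replaces M + z, which does not change the limit.\<close>

lemma prod_shift_reflect_tendsto_sin:
  fixes z :: complex
  shows "(\<lambda>M. (\<Prod>m<M. (of_nat m + z) * (of_nat (Suc m) - z) / of_nat (Suc m) ^ 2) * of_nat M) 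
           \<longlonglongrightarrow> sin (of_real pi * z) / of_real pi"
proof -
  define P where "P = (\<lambda>M. \<Prod>m<M. (of_nat m + z) * (of_nat (Suc m) - z) / of_nat (Suc m) ^ 2)"
  define S where "S = (\<lambda>M. z * (\<Prod>k=1..M. 1 - z^2 / of_nat k^2))"
  have PS: "P M * (of_nat M + z) = S M" for M
  proof (induction M)
    case (Suc M)
    have "P (Suc M) * (of_nat (Suc M) + z) =
          P M * (of_nat M + z) * ((of_nat (Suc M) - z) * (of_nat (Suc M) + z) / of_nat (Suc M)^2)"
      by (simp add: P_def)
    also have "(of_nat (Suc M) - z) * (of_nat (Suc M) + z) / of_nat (Suc M)^2 =
               1 - z^2 / of_nat (Suc M)^2"
      by (simp add: power2_eq_square divide_simps del: of_nat_Suc) (simp add: algebra_simps)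
    finally show ?case by (simp add: Suc.IH S_def)
  qed (simp add: P_def S_def)
  have "(\<lambda>M. of_real pi * S M / of_real pi) \<longlonglongrightarrow> sin (of_real pi * z) / of_real pi"
    using sin_product_formula_complex[of z]
    by (intro tendsto_divide) (simp_all add: S_def mult.assoc)
  hence S: "S \<longlonglongrightarrow> sin (of_real pi * z) / of_real pi" by simp
  have "(\<lambda>M. z / of_nat M) \<longlonglongrightarrow> 0" by (rule lim_const_over_n)
  hence "(\<lambda>M. S M / (1 + z / of_nat M)) \<longlonglongrightarrow> sin (of_real pi * z) / of_real pi / (1 + 0)"
    using S by (intro tendsto_intros) auto
  hence *: "(\<lambda>M. S M / (1 + z / of_nat M)) \<longlonglongrightarrow> sin (of_real pi * z) / of_real pi" by simp
  \<comment> \<open>For M > |z| the factor M + z is nonzero and can be cancelled.\<close>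
  have "eventually (\<lambda>M. real M > norm z) sequentially"
    using filterlim_real_sequentially by (auto simp: filterlim_at_top_dense)
  hence "eventually (\<lambda>M. S M / (1 + z / of_nat M) = P M * of_nat M) sequentially"
  proof eventually_elim
    case (elim M)
    hence M: "M > 0" using norm_ge_zero[of z] by (cases M) auto
    have "of_nat M + z \<noteq> 0"
    proof
      assume "of_nat M + z = 0"
      hence "z = - of_nat M" by (simp add: add_eq_0_iff2)
      with elim show False by simp
    qed
    thus ?case using M by (simp add: PS[symmetric] field_simps)
  qed
  from Lim_transform_eventually[OF * this] show ?thesis by (simp add: P_def)
qed

text \<open>Pairing makes the m-th factor 1 + O(1/m^2) uniformly on the disc, so the product
  converges uniformly. The limit is then identified pointwise, as a quotient of two instances of
  \<open>prod_shift_reflect_tendsto_sin\<close>.\<close>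

lemma uniform_limit_paired_product_sin:
  fixes c :: complex and j q :: nat
  assumes j: "0 < j" "j < q"
  shows "uniform_limit (cball 0 R)
     (\<lambda>M x. \<Prod>m<M. (1 + c * x / of_nat (m * q + j)) * (1 - c * x / of_nat (m * q + (q - j))))
     (\<lambda>x. sin (of_real pi * (of_nat j + c * x) / of_nat q) / sin (of_real pi * of_nat j / of_nat q))
     sequentially"
proof -
  define f where "f = (\<lambda>m x. (1 + c * x / of_nat (m * q + j)) * (1 - c * x / of_nat (m * q + (q - j))))"
  \<comment> \<open>With y = c x this bounds |y| |q - 2j - y|, since |y| \<le> |c| R and |q - 2j|
    \<le> q.\<close>
  define C where "C = norm c * R * (real q + norm c * R)"
  have nz: "of_nat (m * q + j) \<noteq> (0::complex)" "of_nat (m * q + (q - j)) \<noteq> (0::complex)" for m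
    using j by (auto simp del: of_nat_add of_nat_mult)
  have bound: "norm (f m x - 1) \<le> C * (1 / (real (Suc m)) ^ 2)" if x: "x \<in> cball 0 R" for m x
  proof -
    define y where "y = c * x"
    have y: "norm y \<le> norm c * R" using x by (simp add: y_def norm_mult mult_left_mono)
    \<comment> \<open>The terms of order 1/m nearly cancel: the two denominators differ by q - 2j,
      independently of m.\<close>
    have "f m x - 1 = y * (of_int (int q - 2 * int j) - y) / (of_nat (m * q + j) * of_nat (m * q + (q - j)))"
    proof -
      have "(1 + y / A) * (1 - y / B) - 1 = y * (B - A - y) / (A * B)" if "A \<noteq> 0" "B \<noteq> 0" for A B
        using that by (simp add: field_simps)
      moreover have "(of_int (int q - 2 * int j) :: complex) =
          of_nat (m * q + (q - j)) - of_nat (m * q + j)"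
        using j by (simp add: of_nat_diff)
      ultimately show ?thesis
        using nz[of m] unfolding f_def y_def[symmetric] by simp
    qed
    also have "norm \<dots> = norm y * norm (of_int (int q - 2 * int j) - y) / (real (m * q + j) * real (m * q + (q - j)))"
      by (simp add: norm_mult norm_divide del: of_nat_add of_nat_mult)
    also have "\<dots> \<le> C / (real (Suc m) * real (Suc m))"
    proof (rule frac_le)
      have "norm (of_int (int q - 2 * int j) - y) \<le> norm (of_int (int q - 2 * int j) :: complex) + norm y"
        by (rule norm_triangle_ineq4)
      also have "norm (of_int (int q - 2 * int j) :: complex) = real_of_int \<bar>int q - 2 * int j\<bar>"
        by (simp only: norm_of_int)
      also have "\<dots> \<le> real q" using j by linarith
      finally have "norm (of_int (int q - 2 * int j) - y) \<le> real q + norm c * R" using y by simp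
      thus "norm y * norm (of_int (int q - 2 * int j) - y) \<le> C"
        unfolding C_def using y by (intro mult_mono) (auto intro: order_trans[OF norm_ge_zero])
      show "0 \<le> C" unfolding C_def
        using order_trans[OF norm_ge_zero y] by simp
      \<comment> \<open>Because 0 < j < q, both denominators are at least m + 1, including for m =
        0.\<close>
      have "m * 1 \<le> m * q" using j by (intro mult_left_mono) auto
      hence "Suc m \<le> m * q + j" "Suc m \<le> m * q + (q - j)" using j by linarith+
      thus "real (Suc m) * real (Suc m) \<le> real (m * q + j) * real (m * q + (q - j))"
        by (intro mult_mono) (simp_all only: of_nat_le_iff of_nat_0_le_iff)
    qed auto
    finally show ?thesis by (simp add: power2_eq_square)
  qed
  have "summable (\<lambda>m. 1 / (real (Suc m)) ^ 2)"
    using inverse_power_summable[of 2, where ?'a = real]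
    by (subst summable_Suc_iff) (simp add: field_simps)
  hence sum: "summable (\<lambda>m. C * (1 / (real (Suc m)) ^ 2))" by (rule summable_mult)
  have "uniformly_convergent_on (cball 0 R) (\<lambda>M x. \<Prod>m<M. f m x)"
  proof (rule uniformly_convergent_on_prod')
    show "continuous_on (cball 0 R) (f m)" for m
      unfolding f_def using nz by (intro continuous_intros) auto
    show "uniformly_convergent_on (cball 0 R) (\<lambda>N x. \<Sum>m<N. norm (f m x - 1))"
      by (rule Weierstrass_m_test'[OF _ sum]) (use bound in auto)
  qed auto
  then obtain h where h: "uniform_limit (cball 0 R) (\<lambda>M x. \<Prod>m<M. f m x) h sequentially"
    by (auto simp: uniformly_convergent_on_def)
  define s where "s = sin (of_real pi * of_nat j / of_nat q :: complex)"
  have s: "s \<noteq> 0"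
  proof -
    have "sin (pi * real j / real q) > 0"
      using j by (intro sin_gt_zero) (auto simp: field_simps)
    moreover have "s = of_real (sin (pi * real j / real q))"
      by (simp add: s_def sin_of_real[symmetric])
    ultimately show ?thesis by simp
  qed
  have "h x = sin (of_real pi * (of_nat j + c * x) / of_nat q) / s" if "x \<in> cball 0 R" for x
  proof -
    define w :: complex where "w = of_nat j / of_nat q"
    define z where "z = (of_nat j + c * x) / of_nat q"
    define P where "P = (\<lambda>(z::complex) M. (\<Prod>m<M. (of_nat m + z) * (of_nat (Suc m) - z) / of_nat (Suc m) ^ 2) * of_nat M)"
    have lim: "(\<lambda>M. P z M / P w M) \<longlonglongrightarrow> (sin (of_real pi * z) / of_real pi) / (sin (of_real pi * w) / of_real pi)"
      unfolding P_def using s by (intro tendsto_divide prod_shift_reflect_tendsto_sin) (auto simp: w_def s_def)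
    \<comment> \<open>Dividing numerators and denominators by q turns the factors into (m + z)/(m +
      w) and (m + 1 - z)/(m + 1 - w); the squares of m + 1 cancel.\<close>
    have ratio: "f m x = ((of_nat m + z) * (of_nat (Suc m) - z) / of_nat (Suc m) ^ 2) /
                  ((of_nat m + w) * (of_nat (Suc m) - w) / of_nat (Suc m) ^ 2)" for m
    proof -
      have q: "of_nat q \<noteq> (0::complex)" using j by simp
      have eqs: "of_nat m + z = (of_nat (m * q + j) + c * x) / of_nat q"
           "of_nat m + w = of_nat (m * q + j) / of_nat q"
           "of_nat (Suc m) - z = (of_nat (m * q + (q - j)) - c * x) / of_nat q"
           "of_nat (Suc m) - w = of_nat (m * q + (q - j)) / of_nat q"
        using q j by (auto simp: z_def w_def field_simps of_nat_diff)
      have *: "(1 + y / A) * (1 - y / B) =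
          ((A + y) / Q * ((B - y) / Q) / S) / (A / Q * (B / Q) / S)"
        if "A \<noteq> 0" "B \<noteq> 0" "Q \<noteq> 0" "S \<noteq> 0" for A B Q S y :: complex
        using that by (simp add: field_simps)
      have "of_nat (Suc m) ^ 2 \<noteq> (0 :: complex)" by (simp del: of_nat_Suc)
      thus ?thesis unfolding f_def eqs by (intro * nz q)
    qed
    \<comment> \<open>The weights M cancel in the quotient as soon as M > 0.\<close>
    have "(\<Prod>m<M. f m x) = P z M / P w M" if "M > 0" for M
      using that unfolding P_def ratio prod_dividef
      by (subst nonzero_mult_divide_mult_cancel_right) auto
    hence "eventually (\<lambda>M. P z M / P w M = (\<Prod>m<M. f m x)) sequentially"
      by (intro eventually_sequentiallyI[of 1]) auto
    from Lim_transform_eventually[OF lim this]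
    have "(\<lambda>M. \<Prod>m<M. f m x) \<longlonglongrightarrow> sin (of_real pi * z) / sin (of_real pi * w)" by simp
    moreover have "(\<lambda>M. \<Prod>m<M. f m x) \<longlonglongrightarrow> h x"
      using h that by (rule tendsto_uniform_limitI)
    ultimately have "h x = sin (of_real pi * z) / sin (of_real pi * w)"
      using LIMSEQ_unique by blast
    thus ?thesis by (simp add: z_def w_def s_def)
  qed
  hence "uniform_limit (cball 0 R) (\<lambda>M x. \<Prod>m<M. f m x)
           (\<lambda>x. sin (of_real pi * (of_nat j + c * x) / of_nat q) / s) sequentially"
    using h by (subst uniform_limit_cong'[where g = "\<lambda>M x. \<Prod>m<M. f m x" and i = h]) auto
  thus ?thesis unfolding f_def s_def .
qed

subsection \<open>Odd characters\<close>

text \<open>For q \<le> 2 the residues 1 and -1 coincide, while \<chi>(1) = \<chi>(-1)^2 = 1 differs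
  from \<chi>(-1) = -1.\<close>

lemma odd_character_modulus_gt_2:
  assumes "dirichlet_character q \<chi>" "odd_character \<chi>"
  shows "q > 2"
proof (rule ccontr)
  assume "\<not> q > 2"
  moreover have "q > 0" and per: "\<And>a. \<chi> (a + int q) = \<chi> a"
    and mult: "\<And>a b. \<chi> (a * b) = \<chi> a * \<chi> b" and neg: "\<chi> (-1) = -1"
    using assms by (auto simp: dirichlet_character_def odd_character_def)
  moreover have "\<chi> 1 = 1" using mult[of "-1" "-1"] neg by simp
  ultimately consider "q = 1" | "q = 2" by linarith
  thus False
  proof cases
    case 1
    thus False using per[of "-1"] per[of 0] neg \<open>\<chi> 1 = 1\<close> by simp
  next
    case 2
    thus False using per[of "-1"] neg \<open>\<chi> 1 = 1\<close> by simp
  qed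
qed

lemma dirichlet_character_periodic:
  assumes "dirichlet_character q \<chi>"
  shows "\<chi> (int (m * q + a)) = \<chi> (int a)"
proof (induction m)
  case (Suc m)
  have "\<chi> (int (Suc m * q + a)) = \<chi> (int (m * q + a) + int q)" by (simp add: algebra_simps)
  thus ?case using assms Suc.IH by (simp add: dirichlet_character_def)
qed auto

lemma odd_character_reflect:
  assumes "dirichlet_character q \<chi>" "odd_character \<chi>" "a \<le> q"
  shows "\<chi> (int (q - a)) = - \<chi> (int a)"
proof -
  have "\<chi> (int (q - a)) = \<chi> (- int a + int q)" using assms(3) by (simp add: of_nat_diff)
  also have "\<dots> = \<chi> (- int a)" using assms(1) unfolding dirichlet_character_def by blast
  also have "\<dots> = \<chi> (-1 * int a)" by simp
  also have "\<dots> = \<chi> (-1) * \<chi> (int a)" using assms(1) unfolding dirichlet_character_def by blast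
  finally show ?thesis using assms(2) by (simp add: odd_character_def)
qed

text \<open>Cut 1..Mq into M blocks of length q. In each block the residues not coprime to q
  contribute 1, and oddness gives the residues j and q - j opposite character values.\<close>

lemma prod_odd_character_pairing:
  fixes x :: complex
  assumes char: "dirichlet_character q \<chi>" and odd: "odd_character \<chi>"
  shows "(\<Prod>k=1..M*q. 1 + \<chi> (int k) * x / of_nat k) =
         (\<Prod>j\<in>Phi_set q. \<Prod>m<M. (1 + \<chi> (int j) * x / of_nat (m * q + j)) *
                                    (1 - \<chi> (int j) * x / of_nat (m * q + (q - j))))"
proof -
  note q = odd_character_modulus_gt_2[OF char odd]
  define g where "g = (\<lambda>k. 1 + \<chi> (int k) * x / of_nat k)"
  have block: "(\<Prod>i\<in>{m*q..<m*q+q}. g (Suc i)) =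
      (\<Prod>j\<in>Phi_set q. (1 + \<chi> (int j) * x / of_nat (m * q + j)) *
                        (1 - \<chi> (int j) * x / of_nat (m * q + (q - j))))" for m
  proof -
    \<comment> \<open>The residues run over 1..q, with q in place of 0, to match the range of
      \<open>totatives q\<close>.\<close>
    have "(\<Prod>i\<in>{m*q..<m*q+q}. g (Suc i)) = (\<Prod>a\<in>{0<..q}. g (m * q + a))"
      by (rule prod.reindex_bij_witness[of _ "\<lambda>a. m * q + a - 1" "\<lambda>i. Suc i - m * q"]) auto
    also have "\<dots> = (\<Prod>a\<in>totatives q. g (m * q + a))"
    proof (rule prod.mono_neutral_right)
      show "\<forall>a\<in>{0<..q} - totatives q. g (m * q + a) = 1"
      proof
        fix a assume "a \<in> {0<..q} - totatives q"
        hence "\<not> coprime (int a) (int q)" by (auto simp: in_totatives_iff)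
        hence "\<chi> (int a) = 0" using char unfolding dirichlet_character_def by blast
        thus "g (m * q + a) = 1"
          unfolding g_def dirichlet_character_periodic[OF char] by simp
      qed
    qed (use totatives_subset in auto)
    also have "\<dots> = (\<Prod>j\<in>Phi_set q. g (m * q + j) * g (m * q + (q - j)))"
      by (rule prod_totatives_halves[OF q])
    also have "\<dots> = (\<Prod>j\<in>Phi_set q. (1 + \<chi> (int j) * x / of_nat (m * q + j)) *
                        (1 - \<chi> (int j) * x / of_nat (m * q + (q - j))))"
    proof (intro prod.cong refl)
      fix j assume "j \<in> Phi_set q"
      hence "j \<le> q" by (auto simp: Phi_set_eq)
      thus "g (m * q + j) * g (m * q + (q - j)) = (1 + \<chi> (int j) * x / of_nat (m * q + j)) *
                        (1 - \<chi> (int j) * x / of_nat (m * q + (q - j)))"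
        unfolding g_def dirichlet_character_periodic[OF char]
        by (simp add: odd_character_reflect[OF char odd] del: of_nat_add of_nat_mult of_nat_diff)
    qed
    finally show ?thesis .
  qed
  have "(\<Prod>k=1..M*q. g k) = (\<Prod>i<M*q. g (Suc i))"
    by (rule prod.reindex_bij_witness[of _ Suc "\<lambda>k. k - 1"]) auto
  also have "\<dots> = (\<Prod>m<M. \<Prod>i\<in>{m*q..<m*q+q}. g (Suc i))"
    by (rule prod.nat_group[symmetric])
  finally show ?thesis
    unfolding block unfolding g_def by (subst prod.swap)
qed

section \<open>Limits of the truncated sums as Taylor coefficients\<close>

definition sine_quotient :: "nat \<Rightarrow> (int \<Rightarrow> complex) \<Rightarrow> complex \<Rightarrow> complex" where
  "sine_quotient q \<chi> x = (\<Prod>j\<in>Phi_set q.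
     sin (of_real pi * (of_nat j + \<chi> (int j) * x) / of_nat q) / sin (of_real pi * of_nat j / of_nat q))"

text \<open>For N = Mq only complete blocks occur, so the generating polynomials converge to
  \<open>sine_quotient q \<chi>\<close> uniformly on the unit disc. Uniform convergence of
  holomorphic functions passes to derivatives at 0, hence to coefficients.\<close>

lemma multiple_L_partial_multiples_tendsto:
  assumes char: "dirichlet_character q \<chi>" and odd: "odd_character \<chi>"
  shows "(\<lambda>M. multiple_L_partial n \<chi> (M * q)) \<longlonglongrightarrow> (deriv ^^ n) (sine_quotient q \<chi>) 0 / fact n"
proof -
  define p where "p = (\<lambda>N. \<Prod>k=1..N. [:1, \<chi> (int k) / of_nat k:])"
  note q = odd_character_modulus_gt_2[OF char odd]
  have "poly (p (M * q)) x = (\<Prod>j\<in>Phi_set q. \<Prod>m<M. (1 + \<chi> (int j) * x / of_nat (m * q + j)) *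
                                    (1 - \<chi> (int j) * x / of_nat (m * q + (q - j))))" for M x
    unfolding prod_odd_character_pairing[OF char odd, symmetric]
    by (simp add: p_def poly_prod mult.commute)
  hence poly_eq: "(\<lambda>M. poly (p (M * q))) = (\<lambda>M x. \<Prod>j\<in>Phi_set q. \<Prod>m<M.
      (1 + \<chi> (int j) * x / of_nat (m * q + j)) * (1 - \<chi> (int j) * x / of_nat (m * q + (q - j))))"
    by (intro ext)
  have "uniform_limit (cball 0 1)
      (\<lambda>M x. \<Prod>j\<in>Phi_set q. \<Prod>m<M. (1 + \<chi> (int j) * x / of_nat (m * q + j)) *
                                    (1 - \<chi> (int j) * x / of_nat (m * q + (q - j))))
      (sine_quotient q \<chi>) sequentially"
    unfolding sine_quotient_def
  proof (intro uniform_limit_prod_compact uniform_limit_paired_product_sin)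
    show "0 < j" "j < q" if "j \<in> Phi_set q" for j
      using that by (auto simp: Phi_set_eq in_totatives_iff)
    show "continuous_on (cball 0 1) (\<lambda>x. sin (of_real pi * (of_nat j + \<chi> (int j) * x) / of_nat q) /
            sin (of_real pi * of_nat j / of_nat q))" for j
      unfolding divide_inverse by (intro continuous_intros)
  qed (auto simp: Phi_set_eq)
  hence "uniform_limit (cball 0 1) (\<lambda>M. poly (p (M * q))) (sine_quotient q \<chi>) sequentially"
    unfolding poly_eq .
  hence "uniform_limit (ball 0 1) (\<lambda>M. poly (p (M * q))) (sine_quotient q \<chi>) sequentially"
    by (rule uniform_limit_on_subset) auto
  hence "(\<lambda>M. (deriv ^^ n) (poly (p (M * q))) 0) \<longlonglongrightarrow> (deriv ^^ n) (sine_quotient q \<chi>) 0"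
    by (rule higher_deriv_complex_uniform_limit) (auto intro!: always_eventually holomorphic_intros)
  hence "(\<lambda>M. (deriv ^^ n) (poly (p (M * q))) 0 / fact n) \<longlonglongrightarrow> (deriv ^^ n) (sine_quotient q \<chi>) 0 / fact n"
    by (intro tendsto_divide tendsto_const) auto
  thus ?thesis
    unfolding higher_deriv_poly_0 p_def coeff_prod_linear_eq_multiple_L_partial by simp
qed

text \<open>There are finitely many classes, so a single threshold K serves all quotients
  \<open>N div q\<close>.\<close>

lemma tendsto_residue_classes:
  fixes u :: "nat \<Rightarrow> 'a :: topological_space"
  assumes q: "q > 0" and lim: "\<And>r. r < q \<Longrightarrow> (\<lambda>M. u (M * q + r)) \<longlonglongrightarrow> l"
  shows "u \<longlonglongrightarrow> l"
proof (rule topological_tendstoI)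
  fix S assume S: "open S" "l \<in> S"
  have "\<forall>r\<in>{..<q}. eventually (\<lambda>M. u (M * q + r) \<in> S) sequentially"
    using lim S by (auto simp: tendsto_def)
  hence "eventually (\<lambda>M. \<forall>r\<in>{..<q}. u (M * q + r) \<in> S) sequentially"
    by (intro eventually_ball_finite) auto
  then obtain K where K: "\<And>M r. M \<ge> K \<Longrightarrow> r < q \<Longrightarrow> u (M * q + r) \<in> S"
    by (auto simp: eventually_sequentially)
  have "u N \<in> S" if "N \<ge> K * q" for N
    using K[of "N div q" "N mod q"] that q by (simp add: less_eq_div_iff_mult_less_eq)
  thus "eventually (\<lambda>N. u N \<in> S) sequentially" by (rule eventually_sequentiallyI)
qed

text \<open>Going from Mq + r to Mq + r + 1 adds a term tending to 0 times a convergent truncated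
  sum of depth n - 1. Induction on r with n arbitrary thus extends the limit from multiples of q to
  every residue class.\<close>

lemma multiple_L_partial_tendsto:
  assumes char: "dirichlet_character q \<chi>" and odd: "odd_character \<chi>"
  shows "multiple_L_partial n \<chi> \<longlonglongrightarrow> (deriv ^^ n) (sine_quotient q \<chi>) 0 / fact n"
proof (rule tendsto_residue_classes)
  show "q > 0" using odd_character_modulus_gt_2[OF char odd] by simp
  show "(\<lambda>M. multiple_L_partial n \<chi> (M * q + r)) \<longlonglongrightarrow> (deriv ^^ n) (sine_quotient q \<chi>) 0 / fact n" for r
  proof (induction r arbitrary: n)
    case 0
    show ?case using multiple_L_partial_multiples_tendsto[OF char odd] by simp
  next
    case (Suc r)
    show ?case
    proof (cases n)
      case 0
      thus ?thesis using Suc.IH[of 0] by simp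
    next
      case n: (Suc m)
      have "filterlim (\<lambda>M. M * q + Suc r) at_top sequentially"
      proof (rule filterlim_at_top_mono[OF filterlim_ident])
        show "\<forall>\<^sub>F M in sequentially. M \<le> M * q + Suc r"
          using \<open>q > 0\<close> by (intro always_eventually allI trans_le_add1) simp
      qed
      hence "(\<lambda>M. \<chi> (int (Suc r)) / of_nat (M * q + Suc r)) \<longlonglongrightarrow> 0"
        by (rule filterlim_compose[OF lim_const_over_n])
      hence "(\<lambda>M. multiple_L_partial n \<chi> (M * q + r) +
                \<chi> (int (Suc r)) / of_nat (M * q + Suc r) * multiple_L_partial m \<chi> (M * q + r))
             \<longlonglongrightarrow> (deriv ^^ n) (sine_quotient q \<chi>) 0 / fact n +
                 0 * ((deriv ^^ m) (sine_quotient q \<chi>) 0 / fact m)"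
        by (intro tendsto_add tendsto_mult Suc.IH)
      \<comment> \<open>By periodicity the numerator of the added factor does not depend on
        M.\<close>
      moreover have "multiple_L_partial n \<chi> (M * q + Suc r) = multiple_L_partial n \<chi> (M * q + r) +
          \<chi> (int (Suc r)) / of_nat (M * q + Suc r) * multiple_L_partial m \<chi> (M * q + r)" for M
        using multiple_L_partial_Suc_Suc[of m \<chi> "M * q + r"]
          dirichlet_character_periodic[OF char, of M "Suc r"]
        by (simp add: n)
      ultimately show ?thesis by simp
    qed
  qed
qed

section \<open>Expansion over sign vectors\<close>

lemma sin_quotient_eq_sum_signs:
  fixes a y s :: complex
  shows "sin (a * y) / s = (\<Sum>e\<in>{1, -1 :: int}. of_int e * exp (\<i> * a * (of_int e * y)) / (\<i> * (2 * s)))"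
  by (simp add: sin_exp_eq diff_divide_distrib mult_ac add_divide_distrib)

text \<open>Each sine is a sum of two exponentials indexed by a sign, so the product expands into a
  sum over choices of signs. The denominators multiply to i^l * epsilon(q) by
  \<open>prod_two_sin_Phi_set\<close>.\<close>

lemma sine_quotient_eq_exp_sum:
  assumes q: "q > 2" and j: "bij_betw j {1..l} (Phi_set q)"
  shows "sine_quotient q \<chi> x = (\<Sum>\<delta> \<in> {1..l} \<rightarrow>\<^sub>E {1, -1 :: int}.
     of_int (\<Prod>k=1..l. \<delta> k) * exp (\<i> * of_real pi * of_int (\<Sum>k=1..l. \<delta> k * int (j k)) / of_nat q) /
       (\<i> ^ l * of_real (epsilon q)) *
     exp (\<i> * of_real pi / of_nat q * (\<Sum>k=1..l. of_int (\<delta> k) * \<chi> (int (j k))) * x))"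
proof -
  define a :: complex where "a = of_real pi / of_nat q"
  define s where "s = (\<lambda>k. sin (a * of_nat (j k)))"
  have "(\<Prod>k=1..l. 2 * s k) = (\<Prod>j\<in>Phi_set q. 2 * sin (a * of_nat j))"
    unfolding s_def by (rule prod.reindex_bij_betw[OF j])
  also have "\<dots> = (\<Prod>j\<in>Phi_set q. of_real (2 * sin (pi * real j / real q)))"
    by (intro prod.cong) (auto simp: a_def sin_of_real[symmetric])
  also have "\<dots> = of_real (epsilon q)"
    using prod_two_sin_Phi_set[OF q] by (simp only: of_real_prod[symmetric])
  finally have s: "(\<Prod>k=1..l. \<i> * (2 * s k)) = \<i> ^ l * of_real (epsilon q)"
    by (simp add: prod.distrib)
  have "sine_quotient q \<chi> x = (\<Prod>k=1..l. sin (a * (of_nat (j k) + \<chi> (int (j k)) * x)) / s k)"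
    unfolding sine_quotient_def prod.reindex_bij_betw[OF j, symmetric] by (simp add: a_def s_def)
  also have "\<dots> = (\<Sum>\<delta> \<in> {1..l} \<rightarrow>\<^sub>E {1, -1 :: int}. \<Prod>k=1..l. of_int (\<delta> k) *
      exp (\<i> * a * (of_int (\<delta> k) * (of_nat (j k) + \<chi> (int (j k)) * x))) / (\<i> * (2 * s k)))"
    unfolding sin_quotient_eq_sum_signs by (rule prod_sum_PiE) auto
  also have "\<dots> = (\<Sum>\<delta> \<in> {1..l} \<rightarrow>\<^sub>E {1, -1 :: int}.
     of_int (\<Prod>k=1..l. \<delta> k) * exp (\<i> * of_real pi * of_int (\<Sum>k=1..l. \<delta> k * int (j k)) / of_nat q) /
       (\<i> ^ l * of_real (epsilon q)) *
     exp (\<i> * of_real pi / of_nat q * (\<Sum>k=1..l. of_int (\<delta> k) * \<chi> (int (j k))) * x))"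
  proof (intro sum.cong refl)
    fix \<delta> :: "nat \<Rightarrow> int"
    have "(\<Prod>k=1..l. exp (\<i> * a * (of_int (\<delta> k) * (of_nat (j k) + \<chi> (int (j k)) * x)))) =
          exp (\<i> * a * (\<Sum>k=1..l. of_int (\<delta> k) * (of_nat (j k) + \<chi> (int (j k)) * x)))"
      by (simp add: exp_sum sum_distrib_left)
    \<comment> \<open>The exponent splits into the constant i pi j(\<delta>) / q and a part linear
      in x.\<close>
    also have "\<i> * a * (\<Sum>k=1..l. of_int (\<delta> k) * (of_nat (j k) + \<chi> (int (j k)) * x)) =
        \<i> * of_real pi * of_int (\<Sum>k=1..l. \<delta> k * int (j k)) / of_nat q +
        \<i> * of_real pi / of_nat q * (\<Sum>k=1..l. of_int (\<delta> k) * \<chi> (int (j k))) * x"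
      by (simp add: a_def ring_distribs sum.distrib sum_distrib_left sum_distrib_right mult_ac
                    sum_divide_distrib)
    finally show "(\<Prod>k=1..l. of_int (\<delta> k) *
      exp (\<i> * a * (of_int (\<delta> k) * (of_nat (j k) + \<chi> (int (j k)) * x))) / (\<i> * (2 * s k))) =
      of_int (\<Prod>k=1..l. \<delta> k) * exp (\<i> * of_real pi * of_int (\<Sum>k=1..l. \<delta> k * int (j k)) / of_nat q) /
       (\<i> ^ l * of_real (epsilon q)) *
     exp (\<i> * of_real pi / of_nat q * (\<Sum>k=1..l. of_int (\<delta> k) * \<chi> (int (j k))) * x)"
      unfolding prod_dividef prod.distrib s[unfolded prod.distrib] by (simp add: exp_add)
  qed
  finally show ?thesis .
qed

theorem theorem4:
  fixes q l :: nat and \<chi> :: "int \<Rightarrow> complex" and j :: "nat \<Rightarrow> nat"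
  assumes "primitive_character q \<chi>"
    and "\<not> principal_character q \<chi>"
    and "odd_character \<chi>"
    and "l = card (Phi_set q)"
    and "bij_betw j {1..l} (Phi_set q)"
  shows "real l = real (totient q) / 2 \<and>
    (\<forall>n\<ge>1.
       convergent (multiple_L_partial n \<chi>) \<and>
       multiple_L n \<chi> =
         \<i> powi (int n - int l) / (of_real (epsilon q) * fact n) * (of_real pi / of_nat q) ^ n *
         (\<Sum>\<delta> \<in> {1..l} \<rightarrow>\<^sub>E {1, -1 :: int}.
            of_int (\<Prod>k=1..l. \<delta> k) *
            exp (\<i> * of_real pi * of_int (\<Sum>k=1..l. \<delta> k * int (j k)) / of_nat q) *
            (\<Sum>k=1..l. of_int (\<delta> k) * \<chi> (int (j k))) ^ n))"
proof (intro conjI allI impI)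
  have char: "dirichlet_character q \<chi>" using assms(1) by (simp add: primitive_character_def)
  note q = odd_character_modulus_gt_2[OF char assms(3)]
  show "real l = real (totient q) / 2"
    using card_Phi_set[OF q] assms(4) by simp
  fix n :: nat
  note lim = multiple_L_partial_tendsto[OF char assms(3), of n]
  show "convergent (multiple_L_partial n \<chi>)" using lim by (auto simp: convergent_def)
  define c where "c = (\<lambda>\<delta> :: nat \<Rightarrow> int. of_int (\<Prod>k=1..l. \<delta> k) *
      exp (\<i> * of_real pi * of_int (\<Sum>k=1..l. \<delta> k * int (j k)) / of_nat q) :: complex)"
  define b where "b = (\<lambda>\<delta> :: nat \<Rightarrow> int. \<Sum>k=1..l. of_int (\<delta> k) * \<chi> (int (j k)))"
  define D where "D = ({1..l} \<rightarrow>\<^sub>E {1, -1 :: int})"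
  \<comment> \<open>As a function of x this is a finite combination of exponentials, so its n-th
    derivative at 0 just weights each coefficient by the n-th power of its frequency.\<close>
  have "sine_quotient q \<chi> = (\<lambda>x. \<Sum>\<delta>\<in>D. c \<delta> / (\<i> ^ l * of_real (epsilon q)) *
          exp (\<i> * of_real pi / of_nat q * b \<delta> * x))"
    unfolding c_def b_def D_def by (rule ext, rule sine_quotient_eq_exp_sum[OF q assms(5)])
  hence "(deriv ^^ n) (sine_quotient q \<chi>) 0 =
      (\<Sum>\<delta>\<in>D. c \<delta> / (\<i> ^ l * of_real (epsilon q)) * (\<i> * of_real pi / of_nat q * b \<delta>) ^ n)"
    by (simp only: higher_deriv_sum_exp mult_zero_right exp_zero mult_1_right)
  hence "multiple_L n \<chi> = (\<Sum>\<delta>\<in>D. c \<delta> / (\<i> ^ l * of_real (epsilon q)) *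
      (\<i> * of_real pi / of_nat q * b \<delta>) ^ n) / fact n"
    using limI[OF lim] by (simp add: multiple_L_def)
  also have "\<dots> = \<i> ^ n / \<i> ^ l / (of_real (epsilon q) * fact n) * (of_real pi / of_nat q) ^ n *
      (\<Sum>\<delta>\<in>D. c \<delta> * b \<delta> ^ n)"
    by (simp add: sum_distrib_left sum_divide_distrib power_mult_distrib power_divide mult_ac)
  \<comment> \<open>The exponent is an integer power because n may be smaller than l.\<close>
  also have "\<i> ^ n / \<i> ^ l = \<i> powi (int n - int l)"
    by (simp add: power_int_diff)
  finally show "multiple_L n \<chi> =
         \<i> powi (int n - int l) / (of_real (epsilon q) * fact n) * (of_real pi / of_nat q) ^ n *
         (\<Sum>\<delta> \<in> {1..l} \<rightarrow>\<^sub>E {1, -1 :: int}.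
            of_int (\<Prod>k=1..l. \<delta> k) *
            exp (\<i> * of_real pi * of_int (\<Sum>k=1..l. \<delta> k * int (j k)) / of_nat q) *
            (\<Sum>k=1..l. of_int (\<delta> k) * \<chi> (int (j k))) ^ n)"
    by (simp only: c_def b_def D_def)
qed

end
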